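(* For every $3K_1$-free graph $G$ on $n$ vertices, we have $\operatorname{diam}\mathcal{C}_{\chi(G)+1}(G)\le\lfloor(3+1/2)n\rfloor$.
   Context: $\chi(G)$ is the chromatic number of $G$. A graph is $3K_1$-free if it has no three pairwise non-adjacent vertices. $\mathcal{C}_\ell(G)$ is the graph whose vertices are the proper vertex colourings of $G$ with colours from $\{1,\dots,\ell\}$, two being adjacent precisely when they differ in the colour of exactly one vertex; its diameter is the maximum distance between two of its vertices ($\infty$ if disconnected). *)

theory Defs
  imports
    "Graph_Theory.Pair_Digraph"
    "Graph_Theory.Shortest_Path"
    "HOL-Library.FuncSet"
begin

text \<open>
  A finite simple graph is a \<^locale>\<open>pair_graph\<close>: finite, loop-free, with at most one arc from a
  vertex to another, and with a symmetric arc relation. The graph with no vertices is included.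
\<close>

definition three_K1_free :: "'a pair_pre_digraph \<Rightarrow> bool" where
  "three_K1_free G \<longleftrightarrow>
    \<not> (\<exists>x\<in>pverts G. \<exists>y\<in>pverts G. \<exists>z\<in>pverts G.
        x \<noteq> y \<and> x \<noteq> z \<and> y \<noteq> z \<and>
        (x, y) \<notin> parcs G \<and> (x, z) \<notin> parcs G \<and> (y, z) \<notin> parcs G)"

text \<open>
  Colourings are extensional functions, so that two colourings are equal as functions
  precisely when they agree on all vertices.
\<close>

definition proper_colourings :: "'a pair_pre_digraph \<Rightarrow> nat \<Rightarrow> ('a \<Rightarrow> nat) set" where
  "proper_colourings G l =
    {c \<in> pverts G \<rightarrow>\<^sub>E {1..l}. \<forall>(u, v)\<in>parcs G. c u \<noteq> c v}"

definition chromatic_number :: "'a pair_pre_digraph \<Rightarrow> nat" where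
  "chromatic_number G = (LEAST k. proper_colourings G k \<noteq> {})"

definition colouring_graph :: "'a pair_pre_digraph \<Rightarrow> nat \<Rightarrow> ('a \<Rightarrow> nat) pair_pre_digraph" where
  "colouring_graph G l =
    \<lparr> pverts = proper_colourings G l,
      parcs = {(c, d). c \<in> proper_colourings G l \<and> d \<in> proper_colourings G l \<and>
                       (\<exists>!v. v \<in> pverts G \<and> c v \<noteq> d v)} \<rparr>"

text \<open>
  With unit weights the cost of a walk is its length, so this is the usual distance;
  it is \<open>\<infinity>\<close> if there is no walk from \<open>u\<close> to \<open>v\<close>.
\<close>

definition graph_dist :: "'a pair_pre_digraph \<Rightarrow> 'a \<Rightarrow> 'a \<Rightarrow> ereal" where
  "graph_dist G u v = wf_digraph.\<mu> (with_proj G) (\<lambda>_. 1) u v"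

definition diameter :: "'a pair_pre_digraph \<Rightarrow> ereal" where
  "diameter G = (SUP u\<in>pverts G. SUP v\<in>pverts G. graph_dist G u v)"

lemma finite_proper_colourings:
  assumes "finite (pverts G)"
  shows "finite (proper_colourings G l)"
  using finite_PiE[OF assms, of "\<lambda>_. {1..l}"] by (auto simp: proper_colourings_def)

lemma pair_graph_colouring_graph:
  assumes "pair_graph G"
  shows "pair_graph (colouring_graph G l)"
proof -
  interpret pair_graph G by fact
  have fin: "finite (proper_colourings G l)"
    by (rule finite_proper_colourings) simp
  have "finite (parcs (colouring_graph G l))"
    by (rule finite_subset[OF _ finite_cartesian_product[OF fin fin]])
      (auto simp: colouring_graph_def)
  then show ?thesis
    using fin
    by unfold_locales
      (auto simp: colouring_graph_def symmetric_def arcs_ends_def arc_to_ends_def sym_def image_iff)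
qed

lemma proper_colourings_chromatic_number:
  assumes "pair_graph G"
  shows "proper_colourings G (chromatic_number G) \<noteq> {}"
proof -
  interpret pair_graph G by fact
  obtain f where f: "bij_betw f (pverts G) {1..card (pverts G)}"
    using finite_same_card_bij[of "pverts G" "{1..card (pverts G)}"] by auto
  have mem: "u \<in> pverts G \<and> v \<in> pverts G" if "(u, v) \<in> parcs G" for u v
    using arc_fst_in_verts[OF that] arc_snd_in_verts[OF that] by auto
  have ne: "f u \<noteq> f v" if "(u, v) \<in> parcs G" for u v
  proof
    assume "f u = f v"
    then have "u = v"
      using f mem[OF that] by (auto simp: bij_betw_def dest: inj_onD)
    then show False
      using pair_no_loops[OF that] by simp
  qed
  have "restrict f (pverts G) \<in> pverts G \<rightarrow>\<^sub>E {1..card (pverts G)}"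
    using bij_betwE[OF f] by auto
  moreover have "\<forall>(u, v)\<in>parcs G. restrict f (pverts G) u \<noteq> restrict f (pverts G) v"
    using ne mem by (auto simp: restrict_def)
  ultimately have "restrict f (pverts G) \<in> proper_colourings G (card (pverts G))"
    by (simp add: proper_colourings_def)
  then have "proper_colourings G (card (pverts G)) \<noteq> {}"
    by blast
  then show ?thesis
    unfolding chromatic_number_def by (rule LeastI[of "\<lambda>k. proper_colourings G k \<noteq> {}"])
qed

lemma graph_dist_conv_walk_length:
  assumes "pair_wf_digraph G"
  shows "graph_dist G u v =
    (INF p\<in>{p. pre_digraph.awalk (with_proj G) u p v}. ereal (real (length p)))"
proof -
  interpret pair_wf_digraph G by fact
  have "awalk_cost (\<lambda>_. 1) p = real (length p)" for p :: "('a \<times> 'a) list"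
    by (induction p) simp_all
  then show ?thesis
    by (simp add: graph_dist_def \<mu>_def)
qed

end

theory Submission
  imports Defs
begin

text \<open>
  Colour classes have at most two vertices. Fix a \<open>\<chi>\<close>-colouring \<open>g\<close>. A colouring \<open>c\<close> reaches one with
  the classes of \<open>g\<close> in at most \<open>3n/4\<close> steps. If a class \<open>{w}\<close> of \<open>c\<close> is not a class of \<open>g\<close>, moving
  the \<open>g\<close>-partner of \<open>w\<close> onto \<open>w\<close> repairs two vertices in one step. Otherwise counting vertices shows
  that \<open>c\<close> and \<open>g\<close> have the same singleton classes and that \<open>c\<close> misses a colour; splitting a
  wrong pair with the missing colour, and then repairing around each of its two vertices, repairs
  four vertices in three steps. Two colourings with the same at most \<open>\<chi>\<close> classes are joined by
  moving entire classes, in at most \<open>2n\<close> steps: if no class can move directly to its final colour,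
  a smallest wrongly coloured class is parked in the missing colour, which frees the final colour
  of a class that is at least as large and pays for both moves. In total this gives \<open>3n/4 + 2n + 3n/4 = 7n/2\<close>.
\<close>

text \<open>A bound on the length, rather than an exact length or a distance, lets estimates add up
  along concatenated walks with all arithmetic in \<open>nat\<close>.\<close>

definition recolourable ::
    "'a pair_pre_digraph \<Rightarrow> nat \<Rightarrow> nat \<Rightarrow> ('a \<Rightarrow> nat) \<Rightarrow> ('a \<Rightarrow> nat) \<Rightarrow> bool" where
  "recolourable G l m c d \<longleftrightarrow>
    (\<exists>p. pre_digraph.awalk (with_proj (colouring_graph G l)) c p d \<and> length p \<le> m)"

definition colour_class :: "'a pair_pre_digraph \<Rightarrow> ('a \<Rightarrow> nat) \<Rightarrow> 'a \<Rightarrow> 'a set" where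
  "colour_class G c v = {u \<in> pverts G. c u = c v}"

definition singletons :: "'a pair_pre_digraph \<Rightarrow> ('a \<Rightarrow> nat) \<Rightarrow> 'a set" where
  "singletons G c = {v \<in> pverts G. colour_class G c v = {v}}"

text \<open>Only the partitions are compared, not the colours: the set is empty when
  \<open>c\<close> and \<open>g\<close> agree up to renaming colours. Its cardinality is the
  potential of the repair phase.\<close>

definition misplaced :: "'a pair_pre_digraph \<Rightarrow> ('a \<Rightarrow> nat) \<Rightarrow> ('a \<Rightarrow> nat) \<Rightarrow> 'a set" where
  "misplaced G g c = {v \<in> pverts G. colour_class G c v \<noteq> colour_class G g v}"

context pair_graph
begin

section \<open>Proper colourings and walks between them\<close>

lemma proper_colouringsI:
  assumes "\<And>v. v \<in> pverts G \<Longrightarrow> c v \<in> {1..l}" "\<And>v. v \<notin> pverts G \<Longrightarrow> c v = undefined"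
    and "\<And>u v. (u, v) \<in> parcs G \<Longrightarrow> c u \<noteq> c v"
  shows "c \<in> proper_colourings G l"
  using assms by (auto simp: proper_colourings_def PiE_iff extensional_def)

lemma proper_colouringsD:
  assumes "c \<in> proper_colourings G l"
  shows "v \<in> pverts G \<Longrightarrow> c v \<in> {1..l}" "v \<notin> pverts G \<Longrightarrow> c v = undefined"
    and "(u, v) \<in> parcs G \<Longrightarrow> c u \<noteq> c v"
  using assms by (auto simp: proper_colourings_def PiE_iff extensional_def)

lemma card_image_le_colours:
  assumes "c \<in> proper_colourings G l"
  shows "card (c ` pverts G) \<le> l"
proof -
  have "c ` pverts G \<subseteq> {1..l}"
    using proper_colouringsD(1)[OF assms] by blast
  then have "card (c ` pverts G) \<le> card {1..l}"
    by (intro card_mono) simp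
  then show ?thesis
    by simp
qed

lemma arc_in_verts: "(u, v) \<in> parcs G \<Longrightarrow> u \<in> pverts G \<and> v \<in> pverts G"
  using arc_fst_in_verts[of "(u, v)"] arc_snd_in_verts[of "(u, v)"] by auto

lemma recolourable_refl:
  assumes "c \<in> proper_colourings G l"
  shows "recolourable G l m c c"
proof -
  interpret CG: pair_graph "colouring_graph G l"
    by (rule pair_graph_colouring_graph) unfold_locales
  have "c \<in> pverts (colouring_graph G l)"
    using assms by (simp add: colouring_graph_def)
  then show ?thesis
    unfolding recolourable_def by (intro exI[of _ "[]"]) (simp add: CG.awalk_Nil_iff)
qed

lemma recolourable_trans:
  assumes "recolourable G l m c d" "recolourable G l k d e"
  shows "recolourable G l (m + k) c e"
proof -
  interpret CG: pair_graph "colouring_graph G l"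
    by (rule pair_graph_colouring_graph) unfold_locales
  obtain p q where "CG.awalk c p d" "length p \<le> m" "CG.awalk d q e" "length q \<le> k"
    using assms unfolding recolourable_def by blast
  then have "CG.awalk c (p @ q) e" "length (p @ q) \<le> m + k"
    by (auto intro: CG.awalk_appendI)
  then show ?thesis
    unfolding recolourable_def by blast
qed

lemma recolourable_mono:
  "recolourable G l m c d \<Longrightarrow> m \<le> k \<Longrightarrow> recolourable G l k c d"
  unfolding recolourable_def by (meson order_trans)

lemma recolourable_arc:
  assumes "(c, d) \<in> parcs (colouring_graph G l)"
  shows "recolourable G l 1 c d"
proof -
  interpret CG: pair_graph "colouring_graph G l"
    by (rule pair_graph_colouring_graph) unfold_locales
  have "CG.awalk c [(c, d)] d"
    using CG.arc_implies_awalk[of "(c, d)"] assms by simp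
  then show ?thesis
    unfolding recolourable_def by (intro exI[of _ "[(c, d)]"]) simp
qed

lemma recolourable_sym:
  assumes "recolourable G l m c d"
  shows "recolourable G l m d c"
proof -
  interpret CG: pair_graph "colouring_graph G l"
    by (rule pair_graph_colouring_graph) unfold_locales
  have "recolourable G l (length p) d c" if "CG.awalk c p d" for p
    using that
  proof (induction p arbitrary: c)
    case Nil
    then have "c = d" "d \<in> pverts (colouring_graph G l)"
      by (auto simp: CG.awalk_Nil_iff)
    then show ?case
      by (simp add: colouring_graph_def recolourable_refl)
  next
    case (Cons a p)
    then have a: "a \<in> parcs (colouring_graph G l)" "fst a = c"
      and p: "CG.awalk (snd a) p d"
      by (auto simp: CG.awalk_Cons_iff)
    have "(snd a, c) \<in> parcs (colouring_graph G l)"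
      using a by (cases a) (auto simp: colouring_graph_def eq_commute)
    then show ?case
      using recolourable_trans[OF Cons.IH[OF p] recolourable_arc] by simp
  qed
  then show ?thesis
    using assms unfolding recolourable_def by (meson order_trans)
qed

lemma graph_dist_le:
  assumes "recolourable G l m c d"
  shows "graph_dist (colouring_graph G l) c d \<le> ereal (real m)"
proof -
  interpret CG: pair_graph "colouring_graph G l"
    by (rule pair_graph_colouring_graph) unfold_locales
  obtain p where p: "CG.awalk c p d" "length p \<le> m"
    using assms unfolding recolourable_def by blast
  have "graph_dist (colouring_graph G l) c d \<le> ereal (real (length p))"
    using graph_dist_conv_walk_length[OF CG.pair_wf_digraph_axioms] p(1)
    by (auto intro: INF_lower)
  also have "\<dots> \<le> ereal (real m)"
    using p(2) by simp
  finally show ?thesis .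
qed

section \<open>Moving a vertex, an independent set, a class\<close>

lemma recolour_vertex:
  assumes c: "c \<in> proper_colourings G l" and v: "v \<in> pverts G" and k: "k \<in> {1..l}"
    and free: "\<And>u. (u, v) \<in> parcs G \<Longrightarrow> c u \<noteq> k"
  shows "c(v := k) \<in> proper_colourings G l" "recolourable G l 1 c (c(v := k))"
proof -
  have nl: "(v, v) \<notin> parcs G"
    using pair_no_loops by fastforce
  have free': "c u \<noteq> k" if "(v, u) \<in> parcs G" for u
    using free that arcs_symmetric by blast
  show c': "c(v := k) \<in> proper_colourings G l"
  proof (rule proper_colouringsI)
    show "(c(v := k)) x \<noteq> (c(v := k)) y" if "(x, y) \<in> parcs G" for x y
      using that free[of x] free'[of y] nl proper_colouringsD(3)[OF c that] by auto
  qed (use v k proper_colouringsD(1,2)[OF c] in auto)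
  show "recolourable G l 1 c (c(v := k))"
  \<comment> \<open>Arcs require an actual change of colour, so if \<open>v\<close> already has
    colour \<open>k\<close> the empty walk serves instead.\<close>
  proof (cases "c v = k")
    case True
    then show ?thesis
      using recolourable_refl[OF c] by auto
  next
    case False
    then have "(c, c(v := k)) \<in> parcs (colouring_graph G l)"
      using c c' v by (auto simp: colouring_graph_def)
    then show ?thesis
      by (rule recolourable_arc)
  qed
qed

text \<open>The vertices of \<open>A\<close> move one at a time. Intermediate colourings are proper
  because only vertices of the independent set \<open>A\<close> ever wear \<open>k\<close>.\<close>

lemma recolour_set:
  assumes c: "c \<in> proper_colourings G l" and A: "A \<subseteq> pverts G" and k: "k \<in> {1..l} - c ` pverts G"
    and ind: "\<And>u v. u \<in> A \<Longrightarrow> v \<in> A \<Longrightarrow> (u, v) \<notin> parcs G"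
  defines "c' \<equiv> \<lambda>v. if v \<in> A then k else c v"
  shows "c' \<in> proper_colourings G l \<and> recolourable G l (card A) c c'"
proof -
  have "finite A"
    using A by (rule finite_subset) simp
  then show ?thesis
    using A ind unfolding c'_def
  proof (induction A rule: finite_induct)
    case empty
    then show ?case
      using c by (simp add: recolourable_refl)
  next
    case (insert x A)
    let ?e = "\<lambda>v. if v \<in> A then k else c v"
    have e: "?e \<in> proper_colourings G l" "recolourable G l (card A) c ?e"
      using insert by auto
    have free: "?e u \<noteq> k" if "(u, x) \<in> parcs G" for u
      using that insert.prems(2)[of u x] arc_in_verts[OF that] k by auto
    have eq: "?e(x := k) = (\<lambda>v. if v \<in> insert x A then k else c v)"
      by auto
    have "x \<in> pverts G" "k \<in> {1..l}"
      using insert.prems(1) k by auto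
    note step = recolour_vertex[OF e(1) this free, unfolded eq]
    then show ?case
      using recolourable_trans[OF e(2) step(2)] insert.hyps by simp
  qed
qed

lemma colour_class_subset: "colour_class G c v \<subseteq> pverts G"
  by (auto simp: colour_class_def)

lemma finite_colour_class [simp]: "finite (colour_class G c v)"
  using finite_subset[OF colour_class_subset] by simp

lemma finite_misplaced [simp]: "finite (misplaced G g c)"
  by (simp add: misplaced_def)

lemma colour_class_eq: "u \<in> colour_class G c v \<Longrightarrow> colour_class G c u = colour_class G c v"
  by (auto simp: colour_class_def)

lemma colour_class_independent:
  assumes "c \<in> proper_colourings G l" "u \<in> colour_class G c w" "v \<in> colour_class G c w"
  shows "(u, v) \<notin> parcs G"
  using assms(2,3) proper_colouringsD(3)[OF assms(1), of u v] by (auto simp: colour_class_def)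

lemma recolour_class:
  fixes v :: 'a
  assumes c: "c \<in> proper_colourings G l" and k: "k \<in> {1..l} - c ` pverts G"
  defines "c' \<equiv> \<lambda>u. if u \<in> colour_class G c v then k else c u"
  shows "c' \<in> proper_colourings G l" "recolourable G l (card (colour_class G c v)) c c'"
    and "\<And>x y. x \<in> pverts G \<Longrightarrow> y \<in> pverts G \<Longrightarrow> c' x = c' y \<longleftrightarrow> c x = c y"
proof -
  show "c' \<in> proper_colourings G l" "recolourable G l (card (colour_class G c v)) c c'"
    using recolour_set[OF c colour_class_subset k colour_class_independent[OF c]]
    unfolding c'_def by auto
  show "c' x = c' y \<longleftrightarrow> c x = c y" if "x \<in> pverts G" "y \<in> pverts G" for x y
    using that k by (auto simp: c'_def colour_class_def)
qed

section \<open>Relabelling a fixed partition\<close>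

lemma card_image_eq_if_same_kernel:
  assumes "finite V" "\<And>x y. x \<in> V \<Longrightarrow> y \<in> V \<Longrightarrow> c x = c y \<longleftrightarrow> d x = d y"
  shows "card (c ` V) = card (d ` V)"
proof -
  \<comment> \<open>Sends a colour of \<open>c\<close> to the colour that \<open>d\<close> gives the
    same class; any representative will do because the kernels agree.\<close>
  define h where "h = (\<lambda>k. d (SOME x. x \<in> V \<and> c x = k))"
  have h: "h (c x) = d x" if "x \<in> V" for x
    using someI[of "\<lambda>y. y \<in> V \<and> c y = c x" x] that assms(2) unfolding h_def by blast
  have "inj_on h (c ` V)"
    using h assms(2) by (auto simp: inj_on_def)
  moreover have "h ` c ` V = d ` V"
    using h by force
  ultimately show ?thesis
    by (metis card_image)
qed

lemma relabel_classes:
  assumes "c \<in> proper_colourings G l" "d \<in> proper_colourings G l"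
    and "\<And>x y. x \<in> pverts G \<Longrightarrow> y \<in> pverts G \<Longrightarrow> c x = c y \<longleftrightarrow> d x = d y"
    and "card (d ` pverts G) < l"
  shows "recolourable G l (2 * card {v \<in> pverts G. c v \<noteq> d v}) c d"
  using assms(1,3)
proof (induction "card {v \<in> pverts G. c v \<noteq> d v}" arbitrary: c rule: less_induct)
  case less
  note d = assms(2) and c = less.prems(1) and ker = less.prems(2)
  let ?V = "pverts G"
  let ?bad = "\<lambda>c. {v \<in> ?V. c v \<noteq> d v}"
  let ?cls = "colour_class G c"
  \<comment> \<open>One round: \<open>w\<close> is a vertex of the class being settled, and
    \<open>m\<close> bounds all steps of the round, a parking move included.\<close>
  have step: ?case
    if c'': "c'' \<in> proper_colourings G l" "recolourable G l m c c''"
      and ker'': "\<And>x y. x \<in> ?V \<Longrightarrow> y \<in> ?V \<Longrightarrow> c'' x = c'' y \<longleftrightarrow> d x = d y"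
      and bad: "?bad c'' = ?bad c - ?cls w" and w: "w \<in> ?bad c" and m: "m \<le> 2 * card (?cls w)"
    for c'' m w
  proof -
    have sub: "?cls w \<subseteq> ?bad c"
      using w ker by (auto simp: colour_class_def)
    have "card (?cls w) > 0"
      using w by (auto simp: card_gt_0_iff colour_class_def)
    moreover have "card (?bad c'') = card (?bad c) - card (?cls w)"
      "card (?cls w) \<le> card (?bad c)"
      using sub bad by (auto simp: card_Diff_subset intro: card_mono)
    ultimately have "card (?bad c'') < card (?bad c)"
      and le: "m + 2 * card (?bad c'') \<le> 2 * card (?bad c)"
      using m by auto
    then have "recolourable G l (2 * card (?bad c'')) c'' d"
      using less.hyps c''(1) ker'' by blast
    from recolourable_mono[OF recolourable_trans[OF c''(2) this] le] show ?thesis .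
  qed
  show ?case
  proof (cases "?bad c = {}")
    case True
    \<comment> \<open>Off the vertex set both colourings are \<open>undefined\<close>.\<close>
    then have "c = d"
      using proper_colouringsD(2)[OF c] proper_colouringsD(2)[OF d] by (intro ext) force
    then show ?thesis
      using recolourable_refl[OF c] by simp
  next
    case nonempty: False
    show ?thesis
    proof (cases "\<exists>v \<in> ?bad c. d v \<notin> c ` ?V")
      case True
      then obtain v where v: "v \<in> ?bad c" "d v \<notin> c ` ?V"
        by blast
      let ?c = "\<lambda>u. if u \<in> ?cls v then d v else c u"
      have k: "d v \<in> {1..l} - c ` ?V"
        using v proper_colouringsD(1)[OF d] by auto
      note rc = recolour_class[OF c k, where v = v]
      have dv: "d u = d v" if "u \<in> ?cls v" for u
        using that ker v by (auto simp: colour_class_def)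
      show ?thesis
      proof (rule step[OF rc(1,2)])
        show "?bad ?c = ?bad c - ?cls v"
          using dv by auto
        show "?c x = ?c y \<longleftrightarrow> d x = d y" if "x \<in> ?V" "y \<in> ?V" for x y
          using rc(3)[OF that] ker[OF that] by metis
      qed (use v in auto)
    next
      case False
      \<comment> \<open>No wrongly coloured class can move directly, and a correctly coloured vertex
        already wears its final colour; so every colour of \<open>d\<close> occurs in
        \<open>c\<close>. Equal numbers of classes turn this inclusion into equality.\<close>
      then have "d ` ?V \<subseteq> c ` ?V"
        by force
      moreover have cards: "card (c ` ?V) = card (d ` ?V)"
        by (rule card_image_eq_if_same_kernel) (use ker in auto)
      ultimately have img: "d ` ?V = c ` ?V"
        by (intro card_subset_eq) auto
      \<comment> \<open>A smallest wrong class is chosen for parking, so that parking costs no more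
        than the class settled next.\<close>
      obtain v where v: "v \<in> ?bad c"
        and least: "\<And>w. w \<in> ?bad c \<Longrightarrow> card (?cls v) \<le> card (?cls w)"
        using arg_min_nat_lemma[of "\<lambda>v. v \<in> ?bad c" _ "\<lambda>v. card (?cls v)"] nonempty by blast
      have "\<not> {1..l} \<subseteq> c ` ?V"
        using card_mono[of "c ` ?V" "{1..l}"] cards assms(4) by auto
      then obtain k where k: "k \<in> {1..l} - c ` ?V"
        by blast
      \<comment> \<open>\<open>w\<close> lies in the class whose final colour is occupied by the
        class of \<open>v\<close>.\<close>
      obtain w where w: "w \<in> ?V" "d w = c v"
        using v img by (metis (mono_tags, lifting) imageE imageI mem_Collect_eq)
      have ne: "c w \<noteq> c v"
        using v w ker[of w v] by auto
      let ?c = "\<lambda>u. if u \<in> ?cls v then k else c u"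
      note rc = recolour_class[OF c k, where v = v]
      \<comment> \<open>Parking the whole class of \<open>v\<close> in \<open>k\<close> frees its
        old colour.\<close>
      have k': "c v \<in> {1..l} - ?c ` ?V"
        using k v proper_colouringsD(1)[OF c, of v] by (auto simp: colour_class_def)
      note rc' = recolour_class[OF rc(1) k', where v = w]
      have cls: "colour_class G ?c w = ?cls w"
        using rc(3)[OF _ w(1)] by (simp add: colour_class_def cong: conj_cong)
      let ?e = "\<lambda>u. if u \<in> ?cls w then c v else ?c u"
      have dw: "d u = c v" if "u \<in> ?cls w" for u
        using that ker w by (auto simp: colour_class_def)
      have dv: "d u \<noteq> c u" if "u \<in> ?cls v" for u
        using that ker v by (auto simp: colour_class_def)
      \<comment> \<open>\<open>k\<close> is not a final colour of any vertex, so the parked class,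
        wrong before, stays wrong; the wrong set loses exactly the class of
        \<open>w\<close>.\<close>
      have kd: "d u \<noteq> k" if "u \<in> ?V" for u
        using that img k by auto
      show ?thesis
      proof (rule step[OF rc'(1)[unfolded cls] recolourable_trans[OF rc(2) rc'(2), unfolded cls]])
        show "?bad ?e = ?bad c - ?cls w"
          using dw dv kd by force
        show "w \<in> ?bad c"
          using w ne by auto
        then show "card (?cls v) + card (?cls w) \<le> 2 * card (?cls w)"
          using least by simp
        show "?e x = ?e y \<longleftrightarrow> d x = d y" if "x \<in> ?V" "y \<in> ?V" for x y
          by (rule trans[OF rc'(3)[OF that, unfolded cls] trans[OF rc(3)[OF that] ker[OF that]]])
      qed
    qed
  qed
qed

section \<open>Counting colours and classes\<close>

lemma chromatic_number_le_card_image: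
  assumes c: "c \<in> proper_colourings G l"
  shows "chromatic_number G \<le> card (c ` pverts G)"
proof -
  let ?V = "pverts G"
  \<comment> \<open>Renumbering the colours in use as an initial segment makes \<open>c\<close> a
    proper colouring with exactly that many colours available.\<close>
  obtain h where h: "bij_betw h (c ` ?V) {1..card (c ` ?V)}"
    using finite_same_card_bij[of "c ` ?V" "{1..card (c ` ?V)}"] by auto
  let ?d = "restrict (h \<circ> c) ?V"
  have "?d \<in> proper_colourings G (card (c ` ?V))"
  proof (rule proper_colouringsI)
    show "?d v \<in> {1..card (c ` ?V)}" if "v \<in> ?V" for v
      using bij_betwE[OF h] that by simp
    show "?d u \<noteq> ?d v" if "(u, v) \<in> parcs G" for u v
      using proper_colouringsD(3)[OF c that] arc_in_verts[OF that] bij_betw_imp_inj_on[OF h]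
      by (auto dest: inj_onD)
  qed simp
  then show ?thesis
    unfolding chromatic_number_def by (intro Least_le) auto
qed

lemma colour_class_self: "v \<in> pverts G \<Longrightarrow> v \<in> colour_class G c v"
  by (simp add: colour_class_def)

lemma card_colour_class_le_2:
  assumes "three_K1_free G" "c \<in> proper_colourings G l"
  shows "card (colour_class G c v) \<le> 2"
proof (rule ccontr)
  assume "\<not> ?thesis"
  then obtain B where B: "B \<subseteq> colour_class G c v" "card B = 3"
    by (metis obtain_subset_with_card_n not_less_eq_eq numeral_2_eq_2 numeral_3_eq_3)
  then obtain x y z where xyz: "B = {x, y, z}" "x \<noteq> y" "x \<noteq> z" "y \<noteq> z"
    by (auto simp: card_3_iff)
  then have "(x, y) \<notin> parcs G" "(x, z) \<notin> parcs G" "(y, z) \<notin> parcs G"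
    using B colour_class_independent[OF assms(2)] by auto
  then show False
    using assms(1) xyz B colour_class_subset unfolding three_K1_free_def by fastforce
qed

lemma colour_class_pair:
  assumes "three_K1_free G" "c \<in> proper_colourings G l"
    and "v \<in> pverts G" "u \<in> colour_class G c v" "u \<noteq> v"
  shows "colour_class G c v = {u, v}"
proof -
  have "{u, v} \<subseteq> colour_class G c v"
    using assms by (auto simp: colour_class_def)
  then show ?thesis
    using card_seteq[of "colour_class G c v" "{u, v}"] card_colour_class_le_2[OF assms(1,2), of v]
      assms(5) by simp
qed

text \<open>Double counting: a vertex weighs 2 if it is alone in its class and 1 otherwise. Classes
  have one or two vertices, so every class weighs 2.\<close>

lemma twice_card_image:
  assumes "three_K1_free G" "c \<in> proper_colourings G l"
  shows "2 * card (c ` pverts G) = card (pverts G) + card (singletons G c)"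
proof -
  let ?V = "pverts G"
  have "card (singletons G c) = (\<Sum>v\<in>?V. if colour_class G c v = {v} then 1 else 0)"
    by (simp add: singletons_def sum.If_cases Collect_conj_eq)
  then have "card ?V + card (singletons G c) =
      (\<Sum>v\<in>?V. 1 + (if colour_class G c v = {v} then 1 else 0))"
    unfolding sum.distrib by simp
  also have "\<dots> = (\<Sum>k\<in>c ` ?V. \<Sum>v\<in>{v \<in> ?V. c v = k}. 1 + (if colour_class G c v = {v} then 1 else 0))"
    by (rule sum.image_gen) simp
  also have "\<dots> = (\<Sum>k\<in>c ` ?V. 2)"
  proof (rule sum.cong[OF refl])
    fix k assume "k \<in> c ` ?V"
    then obtain w where w: "w \<in> ?V" "c w = k"
      by auto
    have fib: "{v \<in> ?V. c v = k} = colour_class G c w"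
      using w by (auto simp: colour_class_def)
    show "(\<Sum>v\<in>{v \<in> ?V. c v = k}. 1 + (if colour_class G c v = {v} then 1 else 0)) = (2::nat)"
    proof (cases "colour_class G c w = {w}")
      case True
      then show ?thesis
        unfolding fib by simp
    next
      case False
      then obtain u where u: "u \<in> colour_class G c w" "u \<noteq> w"
        using w colour_class_self by blast
      have "colour_class G c w = {u, w}"
        using colour_class_pair[OF assms w(1) u] .
      moreover from this have "colour_class G c u = {u, w}"
        using colour_class_eq[OF u(1)] by simp
      ultimately show ?thesis
        unfolding fib using u(2) by (simp add: doubleton_eq_iff)
    qed
  qed
  finally show ?thesis
    by simp
qed

section \<open>Repairing classes\<close>

lemma merge_into_singleton:
  assumes free: "three_K1_free G" and c: "c \<in> proper_colourings G l"
    and g: "g \<in> proper_colourings G l'"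
    and w: "w \<in> pverts G" "colour_class G c w = {w}" and v: "v \<in> colour_class G g w" "v \<noteq> w"
  defines "c' \<equiv> c(v := c w)"
  shows "c' \<in> proper_colourings G l" "recolourable G l 1 c c'"
    and "card (misplaced G g c') + 2 \<le> card (misplaced G g c)"
proof -
  have vV: "v \<in> pverts G" and gvw: "g v = g w"
    using v by (auto simp: colour_class_def)
  have single: "u = w" if "u \<in> pverts G" "c u = c w" for u
    using that w(2) by (auto simp: colour_class_def)
  \<comment> \<open>Only \<open>w\<close> wears the colour \<open>c w\<close>, and \<open>w\<close>
    is not adjacent to \<open>v\<close> because \<open>g\<close> colours them alike.\<close>
  have fr: "c u \<noteq> c w" if "(u, v) \<in> parcs G" for u
    using that single arc_in_verts[OF that] proper_colouringsD(3)[OF g that] gvw by metis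
  show "c' \<in> proper_colourings G l" "recolourable G l 1 c c'"
    unfolding c'_def
    using recolour_vertex[OF c vV proper_colouringsD(1)[OF c w(1)] fr] by auto
  have gw: "colour_class G g w = {v, w}" "colour_class G g v = {v, w}"
    using colour_class_pair[OF free g w(1) v] colour_class_eq[OF v(1)] by simp_all
  have c'w: "colour_class G c' w = {v, w}" "colour_class G c' v = {v, w}"
    using single vV w(1) v(2) by (auto simp: colour_class_def c'_def)
  have old: "v \<in> misplaced G g c" "w \<in> misplaced G g c"
  proof -
    have "w \<notin> colour_class G c v"
      using single[OF vV] v(2) by (auto simp: colour_class_def)
    then show "v \<in> misplaced G g c" "w \<in> misplaced G g c"
      using vV w gw v(2) by (auto simp: misplaced_def)
  qed
  \<comment> \<open>A correct class other than \<open>{v, w}\<close> contains neither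
    \<open>v\<close> nor \<open>w\<close>, so the move does not touch it.\<close>
  have keep: "colour_class G c' u = colour_class G g u"
    if u: "u \<in> pverts G" "u \<noteq> v" "u \<noteq> w" and eq: "colour_class G c u = colour_class G g u" for u
  proof -
    have "u \<notin> colour_class G g v"
      using u(2,3) gw(2) by simp
    then have "v \<notin> colour_class G g u"
      using u(1) by (simp add: colour_class_def)
    then have "c v \<noteq> c u"
      using eq vV by (auto simp: colour_class_def)
    moreover have "c w \<noteq> c u"
      using single[of u] u by auto
    ultimately have "colour_class G c' u = colour_class G c u"
      using u by (auto simp: colour_class_def c'_def)
    then show ?thesis
      using eq by simp
  qed
  have "misplaced G g c' \<subseteq> misplaced G g c - {v, w}"
  proof
    fix u assume u: "u \<in> misplaced G g c'"
    then have "u \<noteq> v" "u \<noteq> w"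
      using c'w gw unfolding misplaced_def by auto
    then show "u \<in> misplaced G g c - {v, w}"
      using keep[of u] u unfolding misplaced_def by blast
  qed
  then have "card (misplaced G g c') \<le> card (misplaced G g c - {v, w})"
    by (intro card_mono) simp_all
  moreover have "card {v, w} \<le> card (misplaced G g c)"
    using old by (intro card_mono) simp_all
  ultimately show "card (misplaced G g c') + 2 \<le> card (misplaced G g c)"
    using old v(2) by (simp add: card_Diff_subset)
qed

text \<open>Induction on the number of misplaced vertices, with a budget of 3/4 of a step per
  repaired vertex. The minimality of the chromatic number enters when no singleton class offers a
  repair.\<close>

lemma recolour_to_classes:
  assumes free: "three_K1_free G" and g: "g \<in> proper_colourings G (chromatic_number G)"
    and c: "c \<in> proper_colourings G (chromatic_number G + 1)"
  shows "\<exists>m c'. 4 * m \<le> 3 * card (misplaced G g c) \<and> c' \<in> proper_colourings G (chromatic_number G + 1)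
    \<and> recolourable G (chromatic_number G + 1) m c c' \<and> misplaced G g c' = {}"
  using c
proof (induction "card (misplaced G g c)" arbitrary: c rule: less_induct)
  case less
  let ?l = "chromatic_number G + 1"
  let ?V = "pverts G"
  note c = less.prems
  \<comment> \<open>A round of \<open>j\<close> steps must repair at least \<open>4 * j / 3\<close>
    vertices; with \<open>0 < j\<close> the induction measure drops.\<close>
  have step: ?case
    if c': "c' \<in> proper_colourings G ?l" "recolourable G ?l j c c'"
      and j: "4 * j + 3 * card (misplaced G g c') \<le> 3 * card (misplaced G g c)" "0 < j" for c' j
  proof -
    have "card (misplaced G g c') < card (misplaced G g c)"
      using j by linarith
    from less.hyps[OF this c'(1)] obtain m d where
      m: "4 * m \<le> 3 * card (misplaced G g c')" and d: "d \<in> proper_colourings G ?l"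
        "recolourable G ?l m c' d" "misplaced G g d = {}"
      by blast
    show ?thesis
      using m j d recolourable_trans[OF c'(2) d(2)]
      by (intro exI[of _ "j + m"] exI[of _ d]) auto
  qed
  consider "misplaced G g c = {}" | w v where "w \<in> singletons G c" "v \<in> colour_class G g w" "v \<noteq> w"
    | "singletons G c \<subseteq> singletons G g" "misplaced G g c \<noteq> {}"
    by (auto simp: singletons_def dest: colour_class_self)
  then show ?case
  proof cases
    case 1
    then show ?thesis
      using c recolourable_refl[OF c, of 0] by (intro exI[of _ 0] exI[of _ c]) simp
  next
    case 2
    then have w: "w \<in> ?V" "colour_class G c w = {w}"
      by (auto simp: singletons_def)
    note mrg = merge_into_singleton[OF free c g w 2(2,3)]
    show ?thesis
      by (rule step[OF mrg(1,2)]) (use mrg(3) in auto)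
  next
    case 3
    note gle = card_image_le_colours[OF g]
    have fing: "finite (singletons G g)"
      by (simp add: singletons_def)
    \<comment> \<open>By \<open>twice_card_image\<close> the number of colours used determines the
      number of singletons, and \<open>c\<close> uses at least as many colours as \<open>g\<close>.
      With the inclusion of this case, the two sets are equal.\<close>
    have "card (singletons G g) \<le> card (singletons G c)"
      using twice_card_image[OF free c] twice_card_image[OF free g] gle
        chromatic_number_le_card_image[OF c] by linarith
    then have sing: "singletons G c = singletons G g"
      using card_seteq[OF fing 3(1)] by simp
    \<comment> \<open>Equal singletons force equally many colours in \<open>c\<close> and
      \<open>g\<close>, so one of the \<open>?l\<close> colours is missing in
      \<open>c\<close>.\<close>
    then have "card (c ` ?V) < ?l"
      using twice_card_image[OF free c] twice_card_image[OF free g] gle by simp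
    then have "\<not> {1..?l} \<subseteq> c ` ?V"
      using card_mono[of "c ` ?V" "{1..?l}"] by auto
    then obtain k where k: "k \<in> {1..?l}" "k \<notin> c ` ?V"
      by blast
    obtain v where v: "v \<in> ?V" "colour_class G c v \<noteq> colour_class G g v"
      using 3(2) by (auto simp: misplaced_def)
    then have vs: "v \<notin> singletons G c" "v \<notin> singletons G g"
      using sing by (auto simp: singletons_def)
    obtain u where u: "u \<in> colour_class G c v" "u \<noteq> v"
      using vs(1) v(1) colour_class_self[OF v(1)] by (auto simp: singletons_def)
    obtain w where w: "w \<in> colour_class G g v" "w \<noteq> v"
      using vs(2) v(1) colour_class_self[OF v(1)] by (auto simp: singletons_def)
    have cu: "colour_class G c v = {u, v}" "colour_class G c u = {u, v}"
      using colour_class_pair[OF free c v(1) u] colour_class_eq[OF u(1)] by simp_all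
    have gv: "colour_class G g v = {w, v}"
      using colour_class_pair[OF free g v(1) w] .
    have uV: "u \<in> ?V"
      using u(1) by (simp add: colour_class_def)
    have uw: "u \<noteq> w"
      using v(2) cu(1) gv by metis
    \<comment> \<open>As \<open>u\<close> is not a singleton of \<open>c\<close>, it is none of
      \<open>g\<close> either and has a \<open>g\<close>-partner \<open>y\<close>.\<close>
    have "v \<in> colour_class G c u"
      using cu(2) by simp
    then have "u \<notin> singletons G c"
      using u(2) by (auto simp: singletons_def)
    then have "u \<notin> singletons G g"
      using sing by simp
    then have "colour_class G g u \<noteq> {u}"
      using uV by (simp add: singletons_def)
    then obtain y where y: "y \<in> colour_class G g u" "y \<noteq> u"
      using colour_class_self[OF uV] by blast
    \<comment> \<open>Splitting \<open>{u, v}\<close> leaves two singletons, each of which can then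
      receive its \<open>g\<close>-partner.\<close>
    let ?c1 = "c(v := k)"
    have k_unused: "c x \<noteq> k" if "x \<in> ?V" for x
      using imageI[OF that, of c] k(2) by metis
    have "c x \<noteq> k" if "(x, v) \<in> parcs G" for x
      using k_unused arc_in_verts[OF that] by simp
    then have c1: "?c1 \<in> proper_colourings G ?l" "recolourable G ?l 1 c ?c1"
      using recolour_vertex[OF c v(1) k(1)] by simp_all
    \<comment> \<open>The split affects only the class \<open>{u, v}\<close>, which was not a class
      of \<open>g\<close>; no correct vertex is lost.\<close>
    have "misplaced G g ?c1 \<subseteq> misplaced G g c"
    proof
      fix x assume x: "x \<in> misplaced G g ?c1"
      show "x \<in> misplaced G g c"
      proof (rule ccontr)
        assume "x \<notin> misplaced G g c"
        then have x': "x \<in> ?V" "colour_class G c x = colour_class G g x"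
          using x by (auto simp: misplaced_def)
        then have xv: "x \<noteq> v"
          using v by auto
        have "c x \<noteq> c v"
        proof
          assume "c x = c v"
          then have vx: "v \<in> colour_class G c x"
            using v(1) by (simp add: colour_class_def)
          then have "v \<in> colour_class G g x"
            using x'(2) by simp
          then show False
            using colour_class_eq[OF vx] colour_class_eq[of v g x] x'(2) v(2) by simp
        qed
        then have "colour_class G ?c1 x = colour_class G c x"
          using xv k_unused[OF x'(1)] by (auto simp: colour_class_def)
        then show False
          using x x' by (simp add: misplaced_def)
      qed
    qed
    then have mis1: "card (misplaced G g ?c1) \<le> card (misplaced G g c)"
      by (intro card_mono) simp_all
    have c1v: "colour_class G ?c1 v = {v}"
      using k_unused v(1) by (auto simp: colour_class_def)
    let ?c2 = "?c1(w := ?c1 v)"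
    note c2 = merge_into_singleton[OF free c1(1) g v(1) c1v w]
    have "x = u \<or> x = v" if "x \<in> ?V" "c x = c u" for x
    proof -
      have "x \<in> colour_class G c u"
        using that by (simp add: colour_class_def)
      then show ?thesis
        using cu(2) by simp
    qed
    \<comment> \<open>The second move takes \<open>w\<close> to the colour \<open>k\<close>, and
      \<open>u\<close> differs from \<open>w\<close>, so \<open>u\<close> is still alone.\<close>
    then have c2u: "colour_class G ?c2 u = {u}"
      using uw u(2) uV k_unused[OF uV] by (auto simp: colour_class_def)
    note c3 = merge_into_singleton[OF free c2(1) g uV c2u y]
    note c123 = recolourable_trans[OF recolourable_trans[OF c1(2) c2(2)] c3(2)]
    show ?thesis
    proof (rule step[OF c3(1) c123])
      \<comment> \<open>Three steps against two merges repairing two vertices each: the budget of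
        3/4 is met exactly.\<close>
      show "4 * (1 + 1 + 1) + 3 * card (misplaced G g (?c2(y := ?c2 u))) \<le> 3 * card (misplaced G g c)"
        using c2(3) c3(3) mis1 by simp
    qed simp
  qed
qed

section \<open>Combining the bounds\<close>

lemma recolourable_chromatic_number_plus_1:
  assumes free: "three_K1_free G" and a: "a \<in> proper_colourings G (chromatic_number G + 1)"
    and b: "b \<in> proper_colourings G (chromatic_number G + 1)"
  shows "\<exists>m. 2 * m \<le> 7 * card (pverts G) \<and> recolourable G (chromatic_number G + 1) m a b"
proof -
  let ?l = "chromatic_number G + 1"
  let ?V = "pverts G"
  obtain g where g: "g \<in> proper_colourings G (chromatic_number G)"
    using proper_colourings_chromatic_number[OF pair_graph_axioms] by blast
  have mis: "card (misplaced G g c) \<le> card ?V" for c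
    by (intro card_mono) (auto simp: misplaced_def)
  obtain m a' where a': "4 * m \<le> 3 * card (misplaced G g a)" "a' \<in> proper_colourings G ?l"
      "recolourable G ?l m a a'" "misplaced G g a' = {}"
    using recolour_to_classes[OF free g a] by blast
  obtain k b' where b': "4 * k \<le> 3 * card (misplaced G g b)" "b' \<in> proper_colourings G ?l"
      "recolourable G ?l k b b'" "misplaced G g b' = {}"
    using recolour_to_classes[OF free g b] by blast
  have ker: "c x = c y \<longleftrightarrow> g x = g y" if "misplaced G g c = {}" "x \<in> ?V" "y \<in> ?V" for c x y
  proof -
    have "x \<in> colour_class G c y \<longleftrightarrow> x \<in> colour_class G g y"
      using that by (auto simp: misplaced_def)
    then show ?thesis
      using that by (simp add: colour_class_def)
  qed
  \<comment> \<open>\<open>b'\<close> has the classes of \<open>g\<close>, hence uses fewer than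
    \<open>?l\<close> colours, as relabelling requires.\<close>
  have "card (b' ` ?V) = card (g ` ?V)"
    by (rule card_image_eq_if_same_kernel) (use ker[OF b'(4)] in auto)
  also have "\<dots> < ?l"
    using card_image_le_colours[OF g] by simp
  finally have "recolourable G ?l (2 * card {v \<in> ?V. a' v \<noteq> b' v}) a' b'"
    using ker[OF a'(4)] ker[OF b'(4)] by (intro relabel_classes[OF a'(2) b'(2)]) auto
  moreover have "card {v \<in> ?V. a' v \<noteq> b' v} \<le> card ?V"
    by (intro card_mono) auto
  ultimately have "recolourable G ?l (2 * card ?V) a' b'"
    by (elim recolourable_mono) simp
  \<comment> \<open>The repair of \<open>b\<close> is traversed backwards.\<close>
  then have "recolourable G ?l (m + 2 * card ?V + k) a b"
    using recolourable_trans a'(3) recolourable_sym[OF b'(3)] by blast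
  moreover have "4 * m \<le> 3 * card ?V" "4 * k \<le> 3 * card ?V"
    using a'(1) b'(1) mis[of a] mis[of b] by simp_all
  then have "2 * (m + 2 * card ?V + k) \<le> 7 * card ?V"
    by simp
  ultimately show ?thesis
    by blast
qed

end

theorem corollary6:
  fixes G :: "'a pair_pre_digraph" and n :: nat
  assumes "pair_graph G"
    and "three_K1_free G"
    and "card (pverts G) = n"
  shows "diameter (colouring_graph G (chromatic_number G + 1))
           \<le> ereal (real_of_int \<lfloor>(3 + 1 / 2) * real n\<rfloor>)"
proof -
  interpret pair_graph G by fact
  let ?l = "chromatic_number G + 1"
  have "graph_dist (colouring_graph G ?l) a b \<le> ereal (real_of_int \<lfloor>(3 + 1 / 2) * real n\<rfloor>)"
    if "a \<in> pverts (colouring_graph G ?l)" "b \<in> pverts (colouring_graph G ?l)" for a b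
  proof -
    have "a \<in> proper_colourings G ?l" "b \<in> proper_colourings G ?l"
      using that by (simp_all add: colouring_graph_def)
    from recolourable_chromatic_number_plus_1[OF assms(2) this]
    obtain m where m: "2 * m \<le> 7 * n" "recolourable G ?l m a b"
      using assms(3) by blast
    \<comment> \<open>\<open>m\<close> is an integer, so the bound \<open>7 * n / 2\<close> passes
      to its floor.\<close>
    have "int m \<le> \<lfloor>(3 + 1 / 2) * real n\<rfloor>"
      using m(1) by (simp add: le_floor_iff)
    then have "real m \<le> real_of_int \<lfloor>(3 + 1 / 2) * real n\<rfloor>"
      by linarith
    then show ?thesis
      using graph_dist_le[OF m(2)] by (meson ereal_less_eq(3) order_trans)
  qed
  then show ?thesis
    unfolding diameter_def by (intro SUP_least)
qed

end
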